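(* Let $G=(V,E)$ be a finite digraph with minimum out-degree at least $15$. Then there exists $u\in V$ such that for every $w\in V\setminus\{u\}$ there exists a friendly partition of $G$ that separates $u$ and $w$ (i.e. $u$ and $w$ lie in different parts).
   Context: Digraphs have no loops and no parallel arcs in the same direction. A friendly partition of a digraph $G=(V,E)$ is a partition $\{V_1,V_2\}$ of $V$ into two nonempty sets such that every vertex has at least one out-neighbor in its own part. *)

theory Defs
  imports "Graph_Theory.Digraph" "HOL-Library.Disjoint_Sets"
begin

definition friendly_partition :: "('a, 'b) pre_digraph \<Rightarrow> 'a set set \<Rightarrow> bool" where
  "friendly_partition G P \<longleftrightarrow>
     partition_on (verts G) P \<and> card P = 2 \<and>
     (\<forall>X\<in>P. \<forall>v\<in>X. \<exists>x\<in>X. v \<rightarrow>\<^bsub>G\<^esub> x)"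

definition separates :: "'a set set \<Rightarrow> 'a \<Rightarrow> 'a \<Rightarrow> bool" where
  "separates P u w \<longleftrightarrow> (\<exists>X\<in>P. \<exists>Y\<in>P. X \<noteq> Y \<and> u \<in> X \<and> w \<in> Y)"

end

theory Submission
  imports Defs
begin

text \<open>
  Call a set friendly if each of its vertices has an out-neighbour in it. It suffices to find a
  vertex \<open>u\<close> and two disjoint friendly sets avoiding \<open>u\<close>, both containing out-neighbours of \<open>u\<close>:
  they extend to a partition of the remaining vertices, and \<open>u\<close> can then join either part.

  Such a vertex exists as soon as all out-degrees are at least \<open>d \<ge> 9\<close>. In a minimal
  counterexample with all out-degrees equal to \<open>d\<close>, a nonempty friendly set \<open>C\<close> has at least
  \<open>d - 1\<close> vertices, since otherwise any \<open>u\<close> with an arc into \<open>C\<close> works with \<open>C\<close> and its complement.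
  Contracting an arc must destroy an out-degree, so the ends of each arc have a common
  in-neighbour; hence every in-neighbourhood contains a friendly set and every in-degree is at
  least \<open>d - 1\<close>. Friendly sets with \<open>d - 1\<close> vertices have in-degrees so large that counting arcs
  excludes them. Then all in-degrees are \<open>d\<close> and every in-neighbourhood is a minimal friendly set,
  that is, an induced cycle, which is too rigid for the vertices sending arcs into one such cycle.
\<close>

section \<open>Friendly sets\<close>

definition friendly :: "('a \<Rightarrow> 'a set) \<Rightarrow> 'a set \<Rightarrow> bool" where
  "friendly N A \<longleftrightarrow> (\<forall>a\<in>A. N a \<inter> A \<noteq> {})"

definition core :: "('a \<Rightarrow> 'a set) \<Rightarrow> 'a set \<Rightarrow> 'a set" where
  "core N X = \<Union>{A. A \<subseteq> X \<and> friendly N A}"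

lemma core_subset: "core N X \<subseteq> X"
  by (auto simp: core_def)

lemma friendly_core: "friendly N (core N X)"
  unfolding friendly_def core_def by blast

lemma core_greatest: "A \<subseteq> X \<Longrightarrow> friendly N A \<Longrightarrow> A \<subseteq> core N X"
  by (auto simp: core_def)

lemma core_absorbs:
  assumes "v \<in> X" "N v \<inter> core N X \<noteq> {}"
  shows "v \<in> core N X"
proof -
  have "friendly N (insert v (core N X))"
    using friendly_core[of N X] assms(2) unfolding friendly_def by blast
  then show ?thesis
    using core_greatest[of "insert v (core N X)" X N] core_subset[of N X] assms(1) by blast
qed

lemma core_Diff_core: "core N (X - core N X) = {}"
proof -
  have "core N (X - core N X) \<subseteq> core N X"
    by (rule core_greatest) (use core_subset[of N "X - core N X"] friendly_core in blast)+
  then show ?thesis using core_subset[of N "X - core N X"] by blast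
qed

lemma core_empty_imp_sink:
  assumes "core N X = {}" "Z \<subseteq> X" "Z \<noteq> {}"
  obtains z where "z \<in> Z" "N z \<inter> Z = {}"
proof -
  have "\<not> friendly N Z" using core_greatest[of Z X N] assms by blast
  then show thesis using that unfolding friendly_def by blast
qed

lemma extend_friendly_pair:
  assumes "A \<subseteq> X" "B \<subseteq> X" "A \<inter> B = {}" "friendly N A" "friendly N B" "friendly N X"
  obtains A' B' where "A \<subseteq> A'" "B \<subseteq> B'" "A' \<inter> B' = {}" "A' \<union> B' = X" "friendly N A'" "friendly N B'"
proof
  let ?A = "core N (X - B)"
  have sub: "?A \<subseteq> X - B" by (rule core_subset)
  show "A \<subseteq> ?A" using core_greatest[of A "X - B" N] assms by blast
  show "B \<subseteq> X - ?A" "?A \<inter> (X - ?A) = {}" "?A \<union> (X - ?A) = X" using sub assms by blast+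
  show "friendly N ?A" by (rule friendly_core)
  show "friendly N (X - ?A)"
    unfolding friendly_def
  proof
    fix v assume v: "v \<in> X - ?A"
    show "N v \<inter> (X - ?A) \<noteq> {}"
    proof (cases "v \<in> B")
      case True
      then show ?thesis using assms(2,5) sub unfolding friendly_def by blast
    next
      case False
      then show ?thesis
        using core_absorbs[of v "X - B" N] v assms(6) unfolding friendly_def by blast
    qed
  qed
qed

subsection \<open>Minimal friendly sets\<close>

definition minimal_friendly :: "('a \<Rightarrow> 'a set) \<Rightarrow> 'a set \<Rightarrow> bool" where
  "minimal_friendly N D \<longleftrightarrow>
     D \<noteq> {} \<and> friendly N D \<and> (\<forall>Y\<subseteq>D. Y \<noteq> {} \<longrightarrow> friendly N Y \<longrightarrow> Y = D)"

lemma minimal_friendlyD: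
  assumes "minimal_friendly N D"
  shows "D \<noteq> {}" "friendly N D" "Y \<subseteq> D \<Longrightarrow> Y \<noteq> {} \<Longrightarrow> friendly N Y \<Longrightarrow> Y = D"
  using assms unfolding minimal_friendly_def by blast+

lemma minimal_friendlyI_card:
  assumes "finite D" "D \<noteq> {}" "friendly N D"
    and "\<And>Y. Y \<subseteq> D \<Longrightarrow> Y \<noteq> {} \<Longrightarrow> friendly N Y \<Longrightarrow> card D \<le> card Y"
  shows "minimal_friendly N D"
  unfolding minimal_friendly_def using assms card_seteq[OF assms(1)] by blast

lemma friendly_subset_if_in_neighbours:
  assumes "finite X" "X \<noteq> {}" "\<And>x. x \<in> X \<Longrightarrow> \<exists>z\<in>X. x \<in> N z"
  obtains Y where "Y \<subseteq> X" "Y \<noteq> {}" "friendly N Y"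
proof -
  define \<C> where "\<C> = {Y \<in> Pow X. Y \<noteq> {} \<and> (\<forall>x\<in>Y. \<exists>z\<in>Y. x \<in> N z)}"
  have "finite \<C>" "X \<in> \<C>" using assms by (auto simp: \<C>_def)
  then obtain Y where Y: "Y \<in> \<C>" and minimal: "\<And>Y'. Y' \<in> \<C> \<Longrightarrow> Y' \<subseteq> Y \<Longrightarrow> Y = Y'"
    using finite_has_minimal2[of \<C> X] by blast
  from Y obtain g where g: "\<And>x. x \<in> Y \<Longrightarrow> g x \<in> Y \<and> x \<in> N (g x)"
    unfolding \<C>_def by (auto; metis)
  have "g ` Y \<in> \<C>"
  proof -
    have "g ` Y \<subseteq> X" "g ` Y \<noteq> {}" using Y g by (auto simp: \<C>_def)
    moreover have "\<forall>x\<in>g ` Y. \<exists>z\<in>g ` Y. x \<in> N z" using g by blast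
    ultimately show ?thesis by (simp add: \<C>_def)
  qed
  moreover have "g ` Y \<subseteq> Y" using g by blast
  ultimately have "Y = g ` Y" by (rule minimal)
  then have "friendly N Y" using g unfolding friendly_def by (metis IntI empty_iff imageE)
  then show thesis using that Y by (auto simp: \<C>_def)
qed

lemma minimal_friendly_in_neighbour:
  assumes "minimal_friendly N D" "x \<in> D"
  shows "\<exists>z\<in>D. x \<in> N z"
proof (rule ccontr)
  note D = minimal_friendlyD[OF assms(1)]
  assume "\<not> ?thesis"
  then have no_in: "x \<notin> N z" if "z \<in> D" for z using that by blast
  obtain y where "y \<in> N x" "y \<in> D" using D(2) assms(2) unfolding friendly_def by blast
  then have "D - {x} \<noteq> {}" using no_in[OF assms(2)] by blast
  moreover have "friendly N (D - {x})" using D(2) no_in unfolding friendly_def by blast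
  ultimately show False using D(3)[of "D - {x}"] assms(2) by blast
qed

lemma minimal_friendly_choice_bij:
  assumes "minimal_friendly N D" "finite D" and g: "\<And>x. x \<in> D \<Longrightarrow> g x \<in> D \<and> x \<in> N (g x)"
  shows "bij_betw g D D"
proof -
  note D = minimal_friendlyD[OF assms(1)]
  have "finite (g ` D)" "g ` D \<noteq> {}" "\<And>x. x \<in> g ` D \<Longrightarrow> \<exists>z\<in>g ` D. x \<in> N z"
    using assms(2) D(1) g by blast+
  then obtain Y where "Y \<subseteq> g ` D" "Y \<noteq> {}" "friendly N Y"
    by (rule friendly_subset_if_in_neighbours)
  then have "g ` D = D" using D(3)[of Y] g by blast
  then show ?thesis using assms(2) by (simp add: bij_betw_def eq_card_imp_inj_on)
qed

text \<open>Redirecting a choice of in-neighbours at \<open>x\<close> to \<open>a\<close> or \<open>b\<close> gives two permutations that agree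
  away from \<open>x\<close>.\<close>

lemma minimal_friendly_in_neighbour_unique:
  assumes "minimal_friendly N D" "finite D"
    and x: "x \<in> D" and in_nbr: "a \<in> D" "b \<in> D" "x \<in> N a" "x \<in> N b"
  shows "a = b"
proof -
  obtain g where g: "\<And>v. v \<in> D \<Longrightarrow> g v \<in> D \<and> v \<in> N (g v)"
    using minimal_friendly_in_neighbour[OF assms(1)] by metis
  have image_Diff: "g ` (D - {x}) = D - {c}" if "c \<in> D" "x \<in> N c" for c
  proof -
    have "bij_betw (g(x := c)) D D"
      by (rule minimal_friendly_choice_bij[OF assms(1,2)]) (use g that in auto)
    then have "(g(x := c)) ` (D - {x}) = D - {c}"
      using inj_on_image_set_diff[of "g(x := c)" D D "{x}"] x unfolding bij_betw_def by simp
    then show ?thesis by simp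
  qed
  have "D - {a} = D - {b}" using image_Diff in_nbr by metis
  then show ?thesis using in_nbr by blast
qed

lemma minimal_friendly_arc_inside:
  assumes "minimal_friendly N D" "finite D" "2 * card (D - S) < card D"
  obtains p x where "p \<in> D \<inter> S" "x \<in> D \<inter> S" "x \<in> N p"
proof -
  obtain g where g: "\<And>x. x \<in> D \<Longrightarrow> g x \<in> D \<and> x \<in> N (g x)"
    using minimal_friendly_in_neighbour[OF assms(1)] by metis
  have "inj_on g (D \<inter> S)"
    using minimal_friendly_choice_bij[OF assms(1,2) g] by (auto simp: bij_betw_def intro: inj_on_subset)
  have "\<not> g ` (D \<inter> S) \<subseteq> D - S"
  proof
    assume "g ` (D \<inter> S) \<subseteq> D - S"
    then have "card (D \<inter> S) \<le> card (D - S)"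
      using card_inj_on_le[OF \<open>inj_on g (D \<inter> S)\<close>] assms(2) by blast
    then show False using card_Int_Diff[OF assms(2), of S] assms(3) by simp
  qed
  then obtain x where "x \<in> D \<inter> S" "g x \<in> D \<inter> S" using g by blast
  then show thesis using that[of "g x" x] g by blast
qed

section \<open>Splittings\<close>

definition splitting :: "'a set \<Rightarrow> ('a \<Rightarrow> 'a set) \<Rightarrow> 'a \<Rightarrow> 'a set \<Rightarrow> 'a set \<Rightarrow> bool" where
  "splitting V N u A B \<longleftrightarrow> u \<in> V \<and> A \<subseteq> V - {u} \<and> B \<subseteq> V - {u} \<and> A \<inter> B = {} \<and>
     friendly N A \<and> friendly N B \<and> N u \<inter> A \<noteq> {} \<and> N u \<inter> B \<noteq> {}"

definition splittable :: "'a set \<Rightarrow> ('a \<Rightarrow> 'a set) \<Rightarrow> bool" where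
  "splittable V N \<longleftrightarrow> (\<exists>u A B. splitting V N u A B)"

lemma splitting_commute: "splitting V N u A B \<longleftrightarrow> splitting V N u B A"
  unfolding splitting_def by blast

lemma splitting_extend:
  assumes "splitting V N u A B" "friendly N (V - {u})"
  obtains A' B' where "splitting V N u A' B'" "A' \<union> B' = V - {u}"
proof -
  have AB: "A \<subseteq> V - {u}" "B \<subseteq> V - {u}" "A \<inter> B = {}" "friendly N A" "friendly N B"
    using assms(1) unfolding splitting_def by blast+
  obtain A' B' where "A \<subseteq> A'" "B \<subseteq> B'" "A' \<inter> B' = {}" "A' \<union> B' = V - {u}"
    "friendly N A'" "friendly N B'"
    using extend_friendly_pair[OF AB assms(2)] .
  then show thesis using that[of A' B'] assms(1) unfolding splitting_def by blast
qed

text \<open>A retraction moving vertices only along arcs is a simultaneous contraction of arcs, performed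
  here in the subdigraph induced by \<open>S\<close>.\<close>

lemma splittable_retraction:
  assumes "splittable V' N'" "V' \<subseteq> S" "S \<subseteq> V"
    and fixed: "\<And>v. v \<in> V' \<Longrightarrow> \<phi> v = v"
    and moved: "\<And>x. x \<in> S - V' \<Longrightarrow> \<phi> x \<in> N x \<inter> V'"
    and arcs: "\<And>v. v \<in> V' \<Longrightarrow> N' v \<subseteq> \<phi> ` (N v \<inter> S)"
  shows "splittable V N"
proof -
  obtain u A B where split: "splitting V' N' u A B"
    using assms(1) unfolding splittable_def by blast
  define lift where "lift X = {v \<in> S. \<phi> v \<in> X}" for X
  have meets: "N v \<inter> lift X \<noteq> {}" if "v \<in> V'" "N' v \<inter> X \<noteq> {}" for v X
    using that arcs unfolding lift_def by blast
  have friendly_lift: "friendly N (lift X)" if "friendly N' X" "X \<subseteq> V'" for X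
    unfolding friendly_def
  proof
    fix a assume a: "a \<in> lift X"
    show "N a \<inter> lift X \<noteq> {}"
    proof (cases "a \<in> V'")
      case True
      then have "a \<in> X" using a fixed by (simp add: lift_def)
      then show ?thesis using that True meets unfolding friendly_def by blast
    next
      case False
      then have "\<phi> a \<in> N a" "\<phi> a \<in> V'" "\<phi> a \<in> X" using a moved by (auto simp: lift_def)
      then have "\<phi> a \<in> lift X" using fixed \<open>V' \<subseteq> S\<close> by (auto simp: lift_def)
      then show ?thesis using \<open>\<phi> a \<in> N a\<close> by blast
    qed
  qed
  have "lift A \<subseteq> V - {u}" "lift B \<subseteq> V - {u}" "lift A \<inter> lift B = {}" "u \<in> V"
    using split fixed assms(2,3) by (auto simp: lift_def splitting_def)
  then have "splitting V N u (lift A) (lift B)"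
    using split friendly_lift[of A] friendly_lift[of B] meets[of u A] meets[of u B]
    unfolding splitting_def by blast
  then show ?thesis unfolding splittable_def by blast
qed

lemma splittable_mono:
  assumes "splittable V' N'" "V' \<subseteq> V" "\<And>v. v \<in> V' \<Longrightarrow> N' v \<subseteq> N v \<inter> V'"
  shows "splittable V N"
  by (rule splittable_retraction[where S = V' and \<phi> = id]) (use assms in auto)

section \<open>Digraphs of minimum out-degree \<open>d\<close>\<close>

locale min_out_degree =
  fixes V :: "'a set" and N :: "'a \<Rightarrow> 'a set" and d :: nat
  assumes finite_V: "finite V" and V_nonempty: "V \<noteq> {}"
    and N_subset: "v \<in> V \<Longrightarrow> N v \<subseteq> V - {v}"
    and card_N_ge: "v \<in> V \<Longrightarrow> d \<le> card (N v)"
begin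

lemma N_subset_V: "v \<in> V \<Longrightarrow> N v \<subseteq> V"
  using N_subset by blast

lemma not_in_N: "v \<in> V \<Longrightarrow> v \<notin> N v"
  using N_subset by blast

lemma finite_subset_V: "X \<subseteq> V \<Longrightarrow> finite X"
  using finite_V finite_subset by blast

lemma finite_N: "v \<in> V \<Longrightarrow> finite (N v)"
  using N_subset_V finite_subset_V by blast

lemma N_not_subset: "v \<in> V \<Longrightarrow> finite X \<Longrightarrow> card X < d \<Longrightarrow> \<not> N v \<subseteq> X"
  using card_mono[of X "N v"] card_N_ge[of v] by auto

lemma friendly_Diff: "finite X \<Longrightarrow> card X < d \<Longrightarrow> friendly N (V - X)"
  unfolding friendly_def using N_not_subset N_subset_V by blast

lemma card_V_gt: "d < card V"
proof -
  obtain v where v: "v \<in> V" using V_nonempty by blast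
  have "d < card (insert v (N v))" using v card_N_ge[OF v] not_in_N finite_N by simp
  also have "\<dots> \<le> card V" using v N_subset_V by (intro card_mono[OF finite_V]) blast
  finally show ?thesis .
qed

end

section \<open>Minimal unsplittable digraphs\<close>

locale minimal_unsplittable = min_out_degree +
  assumes d_ge_4: "4 \<le> d"
    and card_N: "v \<in> V \<Longrightarrow> card (N v) = d"
    and unsplittable: "\<not> splittable V N"
    and smaller: "V' \<subset> V \<Longrightarrow> min_out_degree V' N' d \<Longrightarrow> splittable V' N'"
begin

definition in_nbrs :: "'a \<Rightarrow> 'a set" where
  "in_nbrs y = {x \<in> V. y \<in> N x}"

definition in_boundary :: "'a set \<Rightarrow> 'a set" where
  "in_boundary C = {u \<in> V - C. N u \<inter> C \<noteq> {}}"

lemma in_nbrs_subset_V: "in_nbrs y \<subseteq> V"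
  by (auto simp: in_nbrs_def)

lemma finite_in_nbrs: "finite (in_nbrs y)"
  by (rule finite_subset_V[OF in_nbrs_subset_V])

lemma in_boundary_subset: "in_boundary C \<subseteq> V - C"
  by (auto simp: in_boundary_def)

lemma finite_in_boundary: "finite (in_boundary C)"
  using in_boundary_subset by (rule finite_subset) (simp add: finite_V)

lemma not_splitting: "\<not> splitting V N u A B"
  using unsplittable unfolding splittable_def by blast

lemma proper_subset_not_closed:
  assumes "V' \<subset> V" "V' \<noteq> {}"
  obtains v where "v \<in> V'" "\<not> N v \<subseteq> V'"
proof (rule ccontr)
  assume "\<not> thesis"
  then have closed: "\<forall>v\<in>V'. N v \<subseteq> V'" using that by blast
  have "min_out_degree V' N d"
    by unfold_locales (use assms closed finite_subset_V[of V'] not_in_N card_N in auto)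
  then have "splittable V' N" by (rule smaller[OF assms(1)])
  then have "splittable V N" by (rule splittable_mono) (use assms(1) closed in auto)
  then show False using unsplittable by blast
qed

lemma no_contractible_matching:
  assumes "W \<subset> V" "W \<noteq> {}" "inj_on f W"
    and out: "\<And>x. x \<in> W \<Longrightarrow> f x \<in> N x - W"
    and apart: "\<And>v. v \<in> V - W \<Longrightarrow> N v \<inter> W \<noteq> {} \<Longrightarrow> insert v (N v) \<inter> f ` W = {}"
  shows False
proof -
  define \<phi> where "\<phi> x = (if x \<in> W then f x else x)" for x
  define N' where "N' v = \<phi> ` N v - {v}" for v
  have \<phi>_V: "\<phi> x \<in> V - W" if "x \<in> V" for x
    using that out N_subset_V by (auto simp: \<phi>_def)
  have degree: "d \<le> card (N' v)" if v: "v \<in> V - W" for v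
  proof (cases "N v \<inter> W = {}")
    case True
    then have "\<phi> ` N v = N v" by (force simp: \<phi>_def)
    then show ?thesis using v card_N not_in_N by (simp add: N'_def)
  next
    case False
    then have disj: "insert v (N v) \<inter> f ` W = {}" using apart v by blast
    then have "inj_on \<phi> (N v)"
      using assms(3) unfolding inj_on_def \<phi>_def by auto
    then have "card (\<phi> ` N v) = d" using v card_N by (simp add: card_image)
    moreover have "v \<notin> \<phi> ` N v" using disj not_in_N v by (auto simp: \<phi>_def)
    ultimately show ?thesis by (simp add: N'_def)
  qed
  have "min_out_degree (V - W) N' d"
  proof
    show "N' v \<subseteq> V - W - {v}" if "v \<in> V - W" for v
      using that N_subset_V[of v] \<phi>_V by (auto simp: N'_def)
  qed (use assms(1) finite_V degree in auto)
  then have "splittable (V - W) N'"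
    using smaller[of "V - W"] assms(1,2) by blast
  then have "splittable V N"
  proof (rule splittable_retraction[where S = V and \<phi> = \<phi>])
    show "N' v \<subseteq> \<phi> ` (N v \<inter> V)" if "v \<in> V - W" for v
      using that N_subset_V[of v] by (auto simp: N'_def)
    show "\<phi> x \<in> N x \<inter> (V - W)" if "x \<in> V - (V - W)" for x
      using that out[of x] \<phi>_V[of x] by (simp add: \<phi>_def)
  qed (auto simp: \<phi>_def)
  then show False using unsplittable by blast
qed

lemma in_boundary_nonempty:
  assumes "C \<subseteq> V" "C \<noteq> {}" "C \<noteq> V"
  shows "in_boundary C \<noteq> {}"
proof -
  have "V - C \<subset> V" "V - C \<noteq> {}" using assms by blast+
  then obtain v where "v \<in> V - C" "\<not> N v \<subseteq> V - C" by (rule proper_subset_not_closed)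
  then show ?thesis using N_subset_V unfolding in_boundary_def by blast
qed

lemma card_friendly_ge_minus_1:
  assumes "C \<subseteq> V" "C \<noteq> {}" "friendly N C"
  shows "d - 1 \<le> card C"
proof (rule ccontr)
  assume small: "\<not> d - 1 \<le> card C"
  then have "C \<noteq> V" using card_V_gt by auto
  then obtain u where u: "u \<in> V" "u \<notin> C" "N u \<inter> C \<noteq> {}"
    using in_boundary_nonempty assms unfolding in_boundary_def by blast
  let ?X = "insert u C"
  have X: "finite ?X" "card ?X < d" using small u assms(1) finite_subset_V by simp_all
  have "splitting V N u C (V - ?X)"
    using u assms friendly_Diff[OF X] N_not_subset[OF u(1) X] N_subset_V[OF u(1)]
    unfolding splitting_def by blast
  then show False using not_splitting by blast
qed

lemma no_digon:
  assumes "x \<in> V" "y \<in> N x"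
  shows "x \<notin> N y"
proof
  assume "x \<in> N y"
  then have "d - 1 \<le> card {x, y}"
    using assms N_subset_V by (intro card_friendly_ge_minus_1) (auto simp: friendly_def)
  then show False using d_ge_4 card_insert_le_m1[of 2 "{y}" x] by simp
qed

lemma arc_dominated:
  assumes x: "x \<in> V" and y: "y \<in> N x"
  obtains z where "z \<in> V" "x \<in> N z" "y \<in> N z"
proof (rule ccontr)
  assume "\<not> thesis"
  then have undominated: "\<forall>z\<in>V. x \<in> N z \<longrightarrow> y \<notin> N z" using that by blast
  have "y \<in> V" "y \<noteq> x" using x y N_subset by blast+
  then show False
    using no_contractible_matching[of "{x}" "\<lambda>_. y"] x y no_digon[OF x y] undominated by auto
qed

lemma in_nbrs_nonempty:
  assumes "y \<in> V"
  shows "in_nbrs y \<noteq> {}"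
proof -
  have "V \<noteq> {y}" using card_V_gt d_ge_4 by auto
  then show ?thesis
    using in_boundary_nonempty[of "{y}"] assms unfolding in_boundary_def in_nbrs_def by blast
qed

text \<open>Walking back along dominators never leaves the in-neighbourhood.\<close>

lemma in_nbrs_friendly_subset:
  assumes "y \<in> V"
  obtains Y where "Y \<subseteq> in_nbrs y" "Y \<noteq> {}" "friendly N Y"
proof (rule friendly_subset_if_in_neighbours[OF finite_in_nbrs in_nbrs_nonempty[OF assms]])
  fix x assume "x \<in> in_nbrs y"
  then have "x \<in> V" "y \<in> N x" by (auto simp: in_nbrs_def)
  then obtain z where "z \<in> V" "x \<in> N z" "y \<in> N z" by (rule arc_dominated)
  then show "\<exists>z\<in>in_nbrs y. x \<in> N z" by (auto simp: in_nbrs_def)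
qed

lemma card_in_nbrs_ge:
  assumes "y \<in> V" "\<And>Y. Y \<subseteq> V \<Longrightarrow> Y \<noteq> {} \<Longrightarrow> friendly N Y \<Longrightarrow> k \<le> card Y"
  shows "k \<le> card (in_nbrs y)"
proof -
  obtain Y where Y: "Y \<subseteq> in_nbrs y" "Y \<noteq> {}" "friendly N Y"
    using in_nbrs_friendly_subset[OF assms(1)] .
  then have "k \<le> card Y" using assms(2) in_nbrs_subset_V by blast
  also have "\<dots> \<le> card (in_nbrs y)" using Y(1) by (rule card_mono[OF finite_in_nbrs])
  finally show ?thesis .
qed

lemma minimal_friendly_in_nbrsI:
  assumes "y \<in> V"
    and least: "\<And>Y. Y \<subseteq> V \<Longrightarrow> Y \<noteq> {} \<Longrightarrow> friendly N Y \<Longrightarrow> card (in_nbrs y) \<le> card Y"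
  shows "minimal_friendly N (in_nbrs y)"
proof (rule minimal_friendlyI_card[OF finite_in_nbrs in_nbrs_nonempty[OF assms(1)]])
  obtain Y where Y: "Y \<subseteq> in_nbrs y" "Y \<noteq> {}" "friendly N Y"
    using in_nbrs_friendly_subset[OF assms(1)] .
  then have "Y = in_nbrs y"
    using card_seteq[OF finite_in_nbrs Y(1)] least in_nbrs_subset_V by blast
  then show "friendly N (in_nbrs y)" using Y(3) by simp
qed (use least in_nbrs_subset_V in blast)

lemma sum_card_in_nbrs: "(\<Sum>y\<in>V. card (in_nbrs y)) = d * card V"
  unfolding in_nbrs_def
proof (rule sum_multicount[OF finite_V finite_V], rule ballI)
  fix x assume "x \<in> V"
  then have "{y \<in> V. y \<in> N x} = N x" using N_subset_V by blast
  then show "card {y \<in> V. y \<in> N x} = d" using \<open>x \<in> V\<close> card_N by simp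
qed

text \<open>The set \<open>Z\<close> consists of the vertices that no friendly set avoiding \<open>u\<close> and \<open>C\<close> contains.\<close>

lemma in_boundary_trapped:
  assumes "C \<subseteq> V" "friendly N C" "u \<in> in_boundary C"
  obtains Z where "Z \<subseteq> V - insert u C" "core N Z = {}" "N u \<subseteq> C \<union> Z"
    "\<And>z. z \<in> Z \<Longrightarrow> N z \<subseteq> insert u (C \<union> Z)"
proof
  define X where "X = V - insert u C"
  let ?Z = "X - core N X"
  have u: "u \<in> V" "u \<notin> C" "N u \<inter> C \<noteq> {}" using assms(3) by (auto simp: in_boundary_def)
  show "?Z \<subseteq> V - insert u C" by (auto simp: X_def)
  show "core N ?Z = {}" by (rule core_Diff_core)
  have "core N X \<subseteq> X" by (rule core_subset)
  then have "N u \<inter> core N X = {}"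
    using not_splitting[of u C "core N X"] u assms friendly_core[of N X]
    unfolding X_def splitting_def by blast
  then show "N u \<subseteq> C \<union> ?Z" using N_subset[OF u(1)] unfolding X_def by blast
  show "N z \<subseteq> insert u (C \<union> ?Z)" if "z \<in> ?Z" for z
    using that core_absorbs[of z X N] N_subset_V[of z] unfolding X_def by blast
qed

subsection \<open>Friendly sets with \<open>d - 1\<close> vertices\<close>

definition small_friendly :: "'a set \<Rightarrow> bool" where
  "small_friendly C \<longleftrightarrow> C \<subseteq> V \<and> friendly N C \<and> card C = d - 1"

lemma small_friendlyD:
  assumes "small_friendly C"
  shows "C \<subseteq> V" "friendly N C" "card C = d - 1" "finite C" "C \<noteq> {}"
  using assms finite_subset_V d_ge_4 by (auto simp: small_friendly_def)

lemma small_friendly_minimal: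
  assumes "small_friendly C"
  shows "minimal_friendly N C"
proof (rule minimal_friendlyI_card)
  note C = small_friendlyD[OF assms]
  fix Y assume "Y \<subseteq> C" "Y \<noteq> {}" "friendly N Y"
  then show "card C \<le> card Y" using card_friendly_ge_minus_1[of Y] C(1,3) by simp
qed (use small_friendlyD[OF assms] in blast)+

lemma small_friendly_trapped_sink:
  assumes "small_friendly C" "u \<in> in_boundary C"
  shows "\<exists>z\<in>in_boundary C. N z = insert u C"
proof -
  note C = small_friendlyD[OF assms(1)]
  obtain Z where Z: "Z \<subseteq> V - insert u C" "core N Z = {}" "N u \<subseteq> C \<union> Z"
    "\<And>z. z \<in> Z \<Longrightarrow> N z \<subseteq> insert u (C \<union> Z)"
    using in_boundary_trapped[OF C(1,2) assms(2)] by blast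
  have u: "u \<in> V" "u \<notin> C" using assms(2) in_boundary_subset by blast+
  have "Z \<noteq> {}" using N_not_subset[OF u(1) C(4)] C(3) Z(3) d_ge_4 by auto
  then obtain z where z: "z \<in> Z" "N z \<inter> Z = {}"
    using core_empty_imp_sink[OF Z(2) order_refl] by blast
  have zV: "z \<in> V - C" using z Z(1) by blast
  have "N z = insert u C"
  proof (rule card_seteq)
    show "N z \<subseteq> insert u C" using Z(4) z by blast
  qed (use C u zV card_N d_ge_4 in simp_all)
  moreover from this have "z \<in> in_boundary C" using zV C(5) by (auto simp: in_boundary_def)
  ultimately show ?thesis by blast
qed

text \<open>The sink attached to \<open>u\<close> determines \<open>u\<close>, so every vertex of the finite in-boundary is such a
  sink.\<close>

lemma N_in_boundary_small_friendly:
  assumes "small_friendly C" "i \<in> in_boundary C"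
  obtains u where "u \<in> in_boundary C" "N i = insert u C"
proof -
  obtain h where h: "\<And>u. u \<in> in_boundary C \<Longrightarrow> h u \<in> in_boundary C \<and> N (h u) = insert u C"
    using small_friendly_trapped_sink[OF assms(1)] by metis
  have "inj_on h (in_boundary C)"
  proof (rule inj_onI)
    fix u v assume same_sink: "u \<in> in_boundary C" "v \<in> in_boundary C" "h u = h v"
    then have "insert u C = insert v C" using h by metis
    then show "u = v" using same_sink in_boundary_subset by blast
  qed
  moreover have "h ` in_boundary C \<subseteq> in_boundary C" using h by blast
  ultimately have "h ` in_boundary C = in_boundary C"
    using endo_inj_surj finite_in_boundary by blast
  then obtain u where "u \<in> in_boundary C" "i = h u" using assms(2) by blast
  then show thesis using that h by blast
qed

lemma small_friendly_subset_N:
  assumes "small_friendly C" "i \<in> in_boundary C"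
  shows "C \<subseteq> N i"
  using N_in_boundary_small_friendly[OF assms] by blast

lemma small_friendly_no_arc_to_in_boundary:
  assumes "small_friendly C" "c \<in> C"
  shows "N c \<inter> in_boundary C = {}"
  using small_friendly_subset_N[OF assms(1)] no_digon[of c] assms(2) small_friendlyD(1)[OF assms(1)]
  by blast

text \<open>A smaller in-boundary could be contracted into \<open>C\<close>.\<close>

lemma card_in_boundary_small_friendly:
  assumes "small_friendly C"
  shows "d \<le> card (in_boundary C)"
proof (rule ccontr)
  note C = small_friendlyD[OF assms]
  let ?W = "in_boundary C"
  assume "\<not> d \<le> card ?W"
  then have "card ?W \<le> card C" using C(3) by simp
  then obtain f where f: "f ` ?W \<subseteq> C" "inj_on f ?W"
    using card_le_inj[OF finite_in_boundary C(4)] by blast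
  show False
  proof (rule no_contractible_matching[OF _ _ f(2)])
    show "?W \<subset> V" using C(1,5) in_boundary_subset by blast
    have "C \<noteq> V" using C(3) card_V_gt by auto
    then show "?W \<noteq> {}" using in_boundary_nonempty C by blast
    show "f x \<in> N x - ?W" if "x \<in> ?W" for x
      using that f(1) small_friendly_subset_N[OF assms] in_boundary_subset by blast
    fix v assume v: "v \<in> V - ?W" "N v \<inter> ?W \<noteq> {}"
    then have "v \<notin> C" using small_friendly_no_arc_to_in_boundary[OF assms] by blast
    then have "insert v (N v) \<inter> C = {}" using v(1) by (auto simp: in_boundary_def)
    then show "insert v (N v) \<inter> f ` ?W = {}" using f(1) by blast
  qed
qed

lemma card_in_nbrs_small_friendly:
  assumes "small_friendly C" "c \<in> C"
  shows "d < card (in_nbrs c)"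
proof -
  note C = small_friendlyD[OF assms(1)]
  obtain p where p: "p \<in> C" "c \<in> N p"
    using minimal_friendly_in_neighbour[OF small_friendly_minimal[OF assms(1)] assms(2)] by blast
  have "p \<notin> in_boundary C" using p in_boundary_subset by blast
  then have "d < card (insert p (in_boundary C))"
    using card_in_boundary_small_friendly[OF assms(1)] finite_in_boundary by simp
  also have "\<dots> \<le> card (in_nbrs c)"
  proof (rule card_mono[OF finite_in_nbrs])
    show "insert p (in_boundary C) \<subseteq> in_nbrs c"
      using p C(1) small_friendly_subset_N[OF assms(1)] assms(2) in_boundary_subset
      unfolding in_nbrs_def by blast
  qed
  finally show ?thesis .
qed

lemma small_friendly_disjoint:
  assumes small: "small_friendly C" "small_friendly C'" and "C \<noteq> C'"
  shows "C \<inter> C' = {}"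
proof (rule ccontr)
  assume meet: "C \<inter> C' \<noteq> {}"
  note C = small_friendlyD[OF small(1)] and C' = small_friendlyD[OF small(2)]
  note minimal = small[THEN small_friendly_minimal]
  have "\<exists>c\<in>C \<inter> C'. \<forall>z\<in>C \<inter> C'. c \<notin> N z"
  proof (rule ccontr)
    assume "\<not> ?thesis"
    then have "\<exists>z\<in>C \<inter> C'. c \<in> N z" if "c \<in> C \<inter> C'" for c using that by blast
    then obtain Y where "Y \<subseteq> C \<inter> C'" "Y \<noteq> {}" "friendly N Y"
      by (rule friendly_subset_if_in_neighbours[OF finite_Int[OF disjI1[OF C(4)]] meet])
    then show False
      using minimal_friendlyD(3)[OF minimal(1), of Y] minimal_friendlyD(3)[OF minimal(2), of Y] assms(3)
      by blast
  qed
  then obtain c where c: "c \<in> C" "c \<in> C'" "\<And>z. z \<in> C \<inter> C' \<Longrightarrow> c \<notin> N z" by blast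
  obtain q where q: "q \<in> C" "c \<in> N q"
    using minimal_friendly_in_neighbour[OF minimal(1) c(1)] by blast
  obtain p where p: "p \<in> C'" "c \<in> N p"
    using minimal_friendly_in_neighbour[OF minimal(2) c(2)] by blast
  have "p \<in> in_boundary C" "q \<in> in_boundary C'"
    using p q c C(1) C'(1) unfolding in_boundary_def by blast+
  then have "q \<in> N p" "p \<in> N q" using small_friendly_subset_N small p(1) q(1) by blast+
  then show False using no_digon[of p q] p C'(1) by blast
qed

text \<open>A vertex dominating an arc from the fibre to \<open>x\<close> lies in \<open>C\<close>; its out-neighbours include the
  whole fibre, \<open>x\<close> and some element of \<open>C\<close>.\<close>

lemma card_in_nbrs_fibre:
  assumes "friendly N C"
  shows "card {y \<in> V. in_nbrs y = C} \<le> d - 2"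
proof (cases "{y \<in> V. in_nbrs y = C} = {}")
  case False
  let ?Y = "{y \<in> V. in_nbrs y = C}"
  from False obtain y where y: "y \<in> V" "in_nbrs y = C" by blast
  obtain x where x: "x \<in> N y" using N_not_subset[OF y(1), of "{}"] d_ge_4 by auto
  obtain z where z: "z \<in> V" "y \<in> N z" "x \<in> N z" using arc_dominated[OF y(1) x] .
  have zC: "z \<in> C" using z y by (auto simp: in_nbrs_def)
  obtain c where c: "c \<in> C" "c \<in> N z" using zC assms unfolding friendly_def by blast
  have YC: "?Y \<inter> C = {}" using not_in_N by (auto simp: in_nbrs_def)
  have "x \<notin> C" using no_digon[OF y(1) x] y(2) by (auto simp: in_nbrs_def)
  moreover have "x \<notin> ?Y" using not_in_N x y by (auto simp: in_nbrs_def)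
  ultimately have "card ?Y + 2 = card (insert c (insert x ?Y))"
    using YC c finite_V by (subst card_insert_disjoint; auto)+
  also have "\<dots> \<le> card (N z)"
    using c z zC by (intro card_mono[OF finite_N]) (auto simp: in_nbrs_def)
  finally show ?thesis using card_N[OF z(1)] by simp
qed (simp only: card.empty)

lemma finite_small_friendly: "finite (Collect small_friendly)"
proof (rule finite_subset)
  show "Collect small_friendly \<subseteq> Pow V" by (auto simp: small_friendly_def)
qed (simp add: finite_V)

lemma card_Union_small_friendly:
  "card (\<Union>(Collect small_friendly)) = (d - 1) * card (Collect small_friendly)"
proof -
  have "card (\<Union>(Collect small_friendly)) = (\<Sum>C\<in>Collect small_friendly. card C)"
    using small_friendly_disjoint small_friendlyD(4)
    by (intro card_Union_disjoint) (auto simp: pairwise_def disjnt_def)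
  also have "\<dots> = (\<Sum>C\<in>Collect small_friendly. d - 1)"
    using small_friendlyD(3) by (intro sum.cong) auto
  finally show ?thesis by simp
qed

lemma card_in_degree_deficient:
  "card {y \<in> V. card (in_nbrs y) < d} \<le> (d - 2) * card (Collect small_friendly)"
proof -
  let ?fibre = "\<lambda>C. {y \<in> V. in_nbrs y = C}"
  have "small_friendly (in_nbrs y)" if y: "y \<in> V" "card (in_nbrs y) < d" for y
  proof -
    have card_eq: "card (in_nbrs y) = d - 1"
      using y(2) card_in_nbrs_ge[OF y(1) card_friendly_ge_minus_1] by simp
    then have "minimal_friendly N (in_nbrs y)"
      using minimal_friendly_in_nbrsI[OF y(1)] card_friendly_ge_minus_1 by simp
    then show ?thesis
      using card_eq in_nbrs_subset_V minimal_friendlyD(2) by (simp add: small_friendly_def)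
  qed
  then have "card {y \<in> V. card (in_nbrs y) < d} \<le> card (\<Union>C\<in>Collect small_friendly. ?fibre C)"
    using finite_small_friendly finite_V by (intro card_mono) auto
  also have "\<dots> \<le> (\<Sum>C\<in>Collect small_friendly. card (?fibre C))"
    by (rule card_UN_le[OF finite_small_friendly])
  also have "\<dots> \<le> (\<Sum>C\<in>Collect small_friendly. d - 2)"
    using card_in_nbrs_fibre small_friendlyD(2) by (intro sum_mono) auto
  finally show ?thesis by (simp add: mult.commute)
qed

text \<open>Double counting of the arcs: each small friendly set carries a surplus of at least \<open>d - 1\<close>
  in its in-degrees, which pays for the at most \<open>d - 2\<close> deficient vertices assigned to it.\<close>

lemma no_small_friendly: "\<not> small_friendly C"
proof -
  define M where "M = \<Union>(Collect small_friendly)"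
  define \<Delta> where "\<Delta> = {y \<in> V. card (in_nbrs y) < d}"
  have "d + of_bool (y \<in> M) \<le> card (in_nbrs y) + of_bool (y \<in> \<Delta>)" if y: "y \<in> V" for y
  proof (cases "y \<in> M")
    case True
    then have "d < card (in_nbrs y)" using card_in_nbrs_small_friendly by (auto simp: M_def)
    then show ?thesis using True by simp
  next
    case False
    have "d - 1 \<le> card (in_nbrs y)" using card_in_nbrs_ge[OF y card_friendly_ge_minus_1] .
    then show ?thesis using False y by (auto simp: \<Delta>_def)
  qed
  then have "(\<Sum>y\<in>V. d + of_bool (y \<in> M)) \<le> (\<Sum>y\<in>V. card (in_nbrs y) + of_bool (y \<in> \<Delta>))"
    by (rule sum_mono)
  then have "card (V \<inter> M) \<le> card (V \<inter> \<Delta>)"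
    using sum_card_in_nbrs finite_V by (simp add: sum.distrib mult.commute)
  moreover have "V \<inter> M = M" "V \<inter> \<Delta> = \<Delta>"
    using small_friendlyD(1) by (auto simp: M_def \<Delta>_def)
  ultimately have "card M \<le> card \<Delta>" by simp
  then have "(d - 1) * card (Collect small_friendly) \<le> (d - 2) * card (Collect small_friendly)"
    using card_Union_small_friendly card_in_degree_deficient unfolding M_def \<Delta>_def by linarith
  then have "card (Collect small_friendly) = 0" using d_ge_4 by fastforce
  then show ?thesis using finite_small_friendly by auto
qed

subsection \<open>The regular case\<close>

lemma card_friendly_ge:
  assumes "C \<subseteq> V" "C \<noteq> {}" "friendly N C"
  shows "d \<le> card C"
  using card_friendly_ge_minus_1[OF assms] no_small_friendly[of C] assms(1,3)
  by (simp add: small_friendly_def)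

lemma card_in_nbrs:
  assumes "y \<in> V"
  shows "card (in_nbrs y) = d"
proof -
  have "(\<Sum>v\<in>V. d) = (\<Sum>v\<in>V. card (in_nbrs v))" using sum_card_in_nbrs by simp
  then show ?thesis
    using sum_mono_inv[of "\<lambda>_. d" V "\<lambda>v. card (in_nbrs v)" y] card_in_nbrs_ge card_friendly_ge
      assms finite_V by metis
qed

lemma minimal_friendly_in_nbrs:
  assumes "y \<in> V"
  shows "minimal_friendly N (in_nbrs y)"
  by (rule minimal_friendly_in_nbrsI[OF assms]) (simp add: card_in_nbrs[OF assms] card_friendly_ge)

lemma arc_dominator_unique:
  assumes "p \<in> V" "x \<in> N p" "z \<in> V" "z' \<in> V" "{p, x} \<subseteq> N z" "{p, x} \<subseteq> N z'"
  shows "z = z'"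
proof (rule minimal_friendly_in_neighbour_unique[OF minimal_friendly_in_nbrs finite_in_nbrs])
  show "x \<in> V" using assms(1,2) N_subset_V by blast
  show "p \<in> in_nbrs x" "z \<in> in_nbrs x" "z' \<in> in_nbrs x" using assms by (auto simp: in_nbrs_def)
  show "p \<in> N z" "p \<in> N z'" using assms by blast+
qed

definition almost_dominates :: "'a \<Rightarrow> 'a set \<Rightarrow> bool" where
  "almost_dominates z C \<longleftrightarrow> z \<in> V \<and> card (C - N z) \<le> 2"

lemma almost_dominatesI:
  assumes "y \<in> V" "z \<in> V" "N z \<subseteq> in_nbrs y \<union> X" "finite X" "card X \<le> 2"
  shows "almost_dominates z (in_nbrs y)"
proof -
  have "card (in_nbrs y - N z) \<le> card (N z - in_nbrs y)"
    using assms(1,2) card_N card_in_nbrs finite_in_nbrs finite_N by (intro card_le_sym_Diff) auto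
  also have "\<dots> \<le> card X" using assms(3,4) by (intro card_mono) auto
  finally show ?thesis using assms(2,5) by (simp add: almost_dominates_def)
qed

text \<open>Two almost dominating vertices miss at most four vertices of the cycle between them, hence at
  most eight of its \<open>d\<close> arcs, so they would dominate a common arc. This is where \<open>d \<ge> 9\<close> comes from.\<close>

lemma almost_dominates_unique:
  assumes "9 \<le> d" "y \<in> V" "almost_dominates z (in_nbrs y)" "almost_dominates z' (in_nbrs y)"
  shows "z = z'"
proof -
  let ?C = "in_nbrs y"
  have few_missed: "z \<in> V" "z' \<in> V" "card (?C - N z) \<le> 2" "card (?C - N z') \<le> 2"
    using assms(3,4) by (auto simp: almost_dominates_def)
  have "card (?C - N z \<inter> N z') \<le> 4"
    using few_missed(3,4) card_Un_le[of "?C - N z" "?C - N z'"] by (simp add: Diff_Int)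
  then have "2 * card (?C - N z \<inter> N z') < card ?C" using assms(1,2) card_in_nbrs by simp
  then obtain p x where arc: "p \<in> ?C \<inter> (N z \<inter> N z')" "x \<in> ?C \<inter> (N z \<inter> N z')" "x \<in> N p"
    using minimal_friendly_arc_inside[OF minimal_friendly_in_nbrs[OF assms(2)] finite_in_nbrs]
    by blast
  then show ?thesis
    using few_missed in_nbrs_subset_V by (intro arc_dominator_unique[of p x]) blast+
qed

lemma in_boundary_not_almost_dominating:
  assumes "9 \<le> d" "y \<in> V"
  obtains u where "u \<in> in_boundary (in_nbrs y)" "\<not> almost_dominates u (in_nbrs y)"
proof (rule ccontr)
  let ?C = "in_nbrs y"
  assume "\<not> thesis"
  then have "\<forall>u\<in>in_boundary ?C. almost_dominates u ?C" using that by blast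
  then have boundary: "card (in_boundary ?C) \<le> 1"
    using almost_dominates_unique[OF assms] finite_in_boundary
    by (auto simp: card_le_Suc0_iff_eq)
  note minimal = minimal_friendly_in_nbrs[OF assms(2)]
  obtain c where c: "c \<in> ?C" using minimal_friendlyD(1)[OF minimal] by blast
  then have cV: "c \<in> V" using in_nbrs_subset_V by blast
  have "a = b" if "a \<in> in_nbrs c \<inter> ?C" "b \<in> in_nbrs c \<inter> ?C" for a b
    using minimal_friendly_in_neighbour_unique[OF minimal finite_in_nbrs c] that
    by (auto simp: in_nbrs_def)
  then have inside: "card (in_nbrs c \<inter> ?C) \<le> 1"
    using finite_in_nbrs by (auto simp: card_le_Suc0_iff_eq)
  have "in_nbrs c \<subseteq> (in_nbrs c \<inter> ?C) \<union> in_boundary ?C"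
    using c by (auto simp: in_nbrs_def in_boundary_def)
  then have "card (in_nbrs c) \<le> card ((in_nbrs c \<inter> ?C) \<union> in_boundary ?C)"
    using finite_in_nbrs finite_in_boundary by (intro card_mono) auto
  also have "\<dots> \<le> 2"
    using inside boundary card_Un_le[of "in_nbrs c \<inter> ?C" "in_boundary ?C"] by simp
  finally show False using card_in_nbrs[OF cV] d_ge_4 by simp
qed

lemma d_less_9: "d < 9"
proof (rule ccontr)
  assume "\<not> d < 9"
  then have d_ge_9: "9 \<le> d" by simp
  obtain y where y: "y \<in> V" using V_nonempty by blast
  let ?C = "in_nbrs y"
  obtain u where u: "u \<in> in_boundary ?C" "\<not> almost_dominates u ?C"
    using in_boundary_not_almost_dominating[OF d_ge_9 y] .
  have uV: "u \<in> V" using u(1) in_boundary_subset by blast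
  obtain Z where Z: "Z \<subseteq> V - insert u ?C" "core N Z = {}" "N u \<subseteq> ?C \<union> Z"
    "\<And>z. z \<in> Z \<Longrightarrow> N z \<subseteq> insert u (?C \<union> Z)"
    using in_boundary_trapped[OF in_nbrs_subset_V _ u(1)]
      minimal_friendlyD(2)[OF minimal_friendly_in_nbrs[OF y]] by blast
  have not_sub: "\<not> Z \<subseteq> {z}" for z
    using almost_dominatesI[OF y uV, of "{z}"] u(2) Z(3) by auto
  then obtain z\<^sub>1 where z1: "z\<^sub>1 \<in> Z" "N z\<^sub>1 \<inter> Z = {}"
    using core_empty_imp_sink[OF Z(2) order_refl] by blast
  obtain z\<^sub>2 where z2: "z\<^sub>2 \<in> Z - {z\<^sub>1}" "N z\<^sub>2 \<inter> (Z - {z\<^sub>1}) = {}"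
    using core_empty_imp_sink[OF Z(2), of "Z - {z\<^sub>1}"] not_sub[of z\<^sub>1] by blast
  have "almost_dominates z ?C" if "z \<in> Z" "N z \<inter> Z \<subseteq> {z\<^sub>1}" for z
  proof (rule almost_dominatesI[OF y])
    show "z \<in> V" "N z \<subseteq> ?C \<union> {u, z\<^sub>1}" using that Z(1) Z(4)[of z] by blast+
    show "card {u, z\<^sub>1} \<le> 2" by (simp add: card_insert_if)
  qed simp
  then have "almost_dominates z\<^sub>1 ?C" "almost_dominates z\<^sub>2 ?C" using z1 z2 by blast+
  then show False using almost_dominates_unique[OF d_ge_9 y] z2(1) by blast
qed

end

theorem splittable_if_min_out_degree_ge_9:
  assumes "min_out_degree V N d" "9 \<le> d"
  shows "splittable V N"
proof -
  have "finite V" using assms(1) by (rule min_out_degree.finite_V)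
  then show ?thesis
    using assms(1)
  proof (induction V arbitrary: N rule: finite_psubset_induct)
    case (psubset V)
    interpret min_out_degree V N d by fact
    have "\<forall>v\<in>V. \<exists>T\<subseteq>N v. card T = d"
      using card_N_ge by (meson obtain_subset_with_card_n)
    then obtain T where T: "\<And>v. v \<in> V \<Longrightarrow> T v \<subseteq> N v \<and> card (T v) = d" by metis
    have "splittable V T"
    proof (rule ccontr)
      assume unsplittable: "\<not> splittable V T"
      have "minimal_unsplittable V T d"
      proof
        show "T v \<subseteq> V - {v}" "d \<le> card (T v)" "card (T v) = d" if "v \<in> V" for v
          using that T[of v] N_subset[of v] by auto
        show "splittable V' N'" if "V' \<subset> V" "min_out_degree V' N' d" for V' N'
          using that by (rule psubset.IH)
      qed (use finite_V V_nonempty unsplittable assms(2) in simp_all)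
      then have "d < 9" by (rule minimal_unsplittable.d_less_9)
      then show False using assms(2) by simp
    qed
    then show ?case by (rule splittable_mono[OF _ order_refl]) (use T N_subset_V in blast)
  qed
qed

section \<open>Friendly partitions\<close>

definition out_nbrs :: "('a, 'b) pre_digraph \<Rightarrow> 'a \<Rightarrow> 'a set" where
  "out_nbrs G v = {x. v \<rightarrow>\<^bsub>G\<^esub> x}"

lemma friendly_partition_pair:
  assumes "A \<noteq> {}" "B \<noteq> {}" "A \<inter> B = {}" "A \<union> B = verts G"
    and "friendly (out_nbrs G) A" "friendly (out_nbrs G) B"
  shows "friendly_partition G {A, B}"
proof -
  have "A \<noteq> B" using assms by blast
  moreover have "partition_on (verts G) {A, B}"
    using assms by (auto simp: partition_on_def disjoint_def)
  ultimately show ?thesis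
    using assms(5,6) unfolding friendly_partition_def friendly_def out_nbrs_def by auto
qed

lemma splitting_imp_separating_partition:
  assumes "splitting (verts G) (out_nbrs G) u A B" "A \<union> B = verts G - {u}" "w \<in> A"
  shows "\<exists>P. friendly_partition G P \<and> separates P u w"
proof (intro exI conjI)
  let ?P = "{A, insert u B}"
  have "friendly (out_nbrs G) (insert u B)"
    using assms(1) unfolding splitting_def friendly_def by blast
  then show "friendly_partition G ?P"
    using assms by (intro friendly_partition_pair) (auto simp: splitting_def)
  have "A \<noteq> insert u B" using assms(1) unfolding splitting_def by blast
  then show "separates ?P u w" using assms(3) unfolding separates_def by auto
qed

context digraph
begin

lemma out_nbrs_subset: "out_nbrs G v \<subseteq> verts G - {v}"
  using adj_not_same by (auto simp: out_nbrs_def)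

lemma card_out_nbrs: "card (out_nbrs G v) = out_degree G v"
proof -
  have "out_nbrs G v = head G ` out_arcs G v"
    by (auto simp: out_nbrs_def out_arcs_def arcs_ends_def arc_to_ends_def)
  moreover have "inj_on (head G) (out_arcs G v)"
    by (rule inj_onI) (auto simp: arc_to_ends_def intro: no_multi_arcs)
  ultimately show ?thesis by (simp add: card_image out_degree_def)
qed

theorem ex_vertex_separated_by_friendly_partitions:
  assumes "verts G \<noteq> {}" "\<forall>v\<in>verts G. 9 \<le> out_degree G v"
  shows "\<exists>u\<in>verts G. \<forall>w\<in>verts G - {u}. \<exists>P. friendly_partition G P \<and> separates P u w"
proof -
  interpret min_out_degree "verts G" "out_nbrs G" 9
    by unfold_locales (use assms out_nbrs_subset card_out_nbrs in auto)
  obtain u A B where "splitting (verts G) (out_nbrs G) u A B"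
    using splittable_if_min_out_degree_ge_9[OF min_out_degree_axioms]
    unfolding splittable_def by blast
  moreover have "friendly (out_nbrs G) (verts G - {u})" by (rule friendly_Diff) simp_all
  ultimately obtain A' B' where
    split: "splitting (verts G) (out_nbrs G) u A' B'" "A' \<union> B' = verts G - {u}"
    by (rule splitting_extend)
  then have "\<exists>P. friendly_partition G P \<and> separates P u w" if "w \<in> verts G - {u}" for w
    using that splitting_imp_separating_partition[of G u A' B' w]
      splitting_imp_separating_partition[of G u B' A' w] splitting_commute[of _ _ u A' B']
    by blast
  moreover have "u \<in> verts G" using split(1) unfolding splitting_def by blast
  ultimately show ?thesis by blast
qed

end

theorem theorem1p6:
  fixes G :: "('a, 'b) pre_digraph"
  assumes "digraph G"
    and "verts G \<noteq> {}"
    and "\<forall>v\<in>verts G. out_degree G v \<ge> 15"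
  shows "\<exists>u\<in>verts G. \<forall>w\<in>verts G - {u}. \<exists>P. friendly_partition G P \<and> separates P u w"
  using digraph.ex_vertex_separated_by_friendly_partitions[OF assms(1,2)] assms(3) by fastforce

end
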